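(* Let $K_{n,n}$ be the complete bipartite graph with both parts of size $n$. Then $\chi_g^\infty(K_{n,n}) \geq 5$ when $n \geq 5$.
   Context: The eternal vertex coloring game (A-game) on a finite undirected graph $G$ with color set $\{1,\ldots,k\}$: all vertices are initially uncolored. Alice and Bob strictly alternate turns, Alice moving first overall. On a turn the player chooses one vertex. If it is uncolored, the player must give it a color not currently used on any of its neighbors; if it currently has color $c$, the player must change its color to a color different from $c$ that is not currently used on any of its neighbors. The player whose turn it is picks the vertex and the new color. Play proceeds in rounds: every vertex must be chosen $t$ times before any vertex is chosen $t+1$ times, for every integer $t\ge 1$ (so each vertex is chosen exactly once per round; turns keep alternating across rounds, so if $|V(G)|$ is odd Bob moves first in even-numbered rounds). If some player chooses a vertex $v$ (still available in the current round) that cannot be legally colored, i.e. every color in the color set other than the current color of $v$ (if any) appears on a neighbor of $v$, then Bob wins. In particular Bob may deliberately choose such a vertex. Alice wins if this never happens (the game goes on forever). The eternal game chromatic number $\chi_g^\infty(G)$ is the minimum $k$ such that Alice has a winning strategy on $G$ with $k$ colors. *)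

theory Defs
  imports Main
begin

text \<open>A graph is a pair of a vertex set and a set of edges, each edge being a set of two vertices.\<close>

type_synonym 'v graph = "'v set \<times> 'v set set"

definition verts :: "'v graph \<Rightarrow> 'v set" where
  "verts G = fst G"

definition edges :: "'v graph \<Rightarrow> 'v set set" where
  "edges G = snd G"

definition complete_bipartite :: "nat \<Rightarrow> nat \<Rightarrow> (nat + nat) graph" where
  "complete_bipartite m n =
     ({..<m} <+> {..<n}, {{Inl i, Inr j} | i j. i < m \<and> j < n})"

datatype player = Alice | Bob

fun opponent :: "player \<Rightarrow> player" where
  "opponent Alice = Bob"
| "opponent Bob = Alice"

text \<open>The field \<open>available\<close> holds the vertices not yet chosen in the current round.\<close>

record 'v position =
  coloring :: "'v \<Rightarrow> nat option"
  available :: "'v set"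
  to_move :: player

type_synonym 'v move = "'v \<times> nat"

definition initial_position :: "'v graph \<Rightarrow> 'v position" where
  "initial_position G = \<lparr>coloring = (\<lambda>_. None), available = verts G, to_move = Alice\<rparr>"

definition legal_colors :: "'v graph \<Rightarrow> nat \<Rightarrow> 'v position \<Rightarrow> 'v \<Rightarrow> nat set" where
  "legal_colors G k p v =
     {x \<in> {1..k}. coloring p v \<noteq> Some x \<and>
        (\<forall>u. {u, v} \<in> edges G \<longrightarrow> coloring p u \<noteq> Some x)}"

text \<open>A player may choose any available vertex, even one without a legal color. In that case the
  color component of the move is irrelevant, as Bob has won.\<close>

definition admissible :: "'v graph \<Rightarrow> nat \<Rightarrow> 'v position \<Rightarrow> 'v move \<Rightarrow> bool" where
  "admissible G k p m \<longleftrightarrow>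
     fst m \<in> available p \<and>
     (legal_colors G k p (fst m) \<noteq> {} \<longrightarrow> snd m \<in> legal_colors G k p (fst m))"

text \<open>Choosing the last available vertex ends the round, and then every vertex becomes available
  again.\<close>

definition make_move :: "'v graph \<Rightarrow> 'v position \<Rightarrow> 'v move \<Rightarrow> 'v position" where
  "make_move G p m =
     \<lparr>coloring = (coloring p)(fst m \<mapsto> snd m),
      available = (if available p = {fst m} then verts G else available p - {fst m}),
      to_move = opponent (to_move p)\<rparr>"

definition position_after :: "'v graph \<Rightarrow> 'v move list \<Rightarrow> 'v position" where
  "position_after G h = foldl (make_move G) (initial_position G) h"

definition bob_has_won :: "'v graph \<Rightarrow> nat \<Rightarrow> 'v move list \<Rightarrow> bool" where
  "bob_has_won G k h \<longleftrightarrow>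
     (\<exists>h' m. h = h' @ [m] \<and> legal_colors G k (position_after G h') (fst m) = {})"

text \<open>Alice's strategies may depend on the whole history of moves (oldest move first).\<close>

type_synonym 'v strategy = "'v move list \<Rightarrow> 'v move"

text \<open>The finite histories that can arise when Alice follows \<open>\<sigma>\<close> and Bob plays arbitrarily.\<close>

inductive play :: "'v graph \<Rightarrow> nat \<Rightarrow> 'v strategy \<Rightarrow> 'v move list \<Rightarrow> bool"
  for G :: "'v graph" and k :: nat and \<sigma> :: "'v strategy" where
  start: "play G k \<sigma> []"
| step: "play G k \<sigma> h \<Longrightarrow> \<not> bob_has_won G k h \<Longrightarrow>
         admissible G k (position_after G h) m \<Longrightarrow>
         (to_move (position_after G h) = Alice \<longrightarrow> m = \<sigma> h) \<Longrightarrow>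
         play G k \<sigma> (h @ [m])"

definition winning_strategy :: "'v graph \<Rightarrow> nat \<Rightarrow> 'v strategy \<Rightarrow> bool" where
  "winning_strategy G k \<sigma> \<longleftrightarrow>
     (\<forall>h. play G k \<sigma> h \<longrightarrow>
        \<not> bob_has_won G k h \<and>
        (to_move (position_after G h) = Alice \<longrightarrow>
           admissible G k (position_after G h) (\<sigma> h)))"

text \<open>For a finite nonempty graph the minimum exists: with more than maximum degree plus one colors
  every vertex always has a legal color.\<close>

definition eternal_game_chromatic_number :: "'v graph \<Rightarrow> nat" where
  "eternal_game_chromatic_number G = (LEAST k. \<exists>\<sigma>. winning_strategy G k \<sigma>)"

end

theory Submission
  imports Defs
begin

text \<open>With at most four colors Bob spends the first round answering on the side \<open>S\<close> where Alice
  started, so that he either wins at once or \<open>S\<close> carries all colors but one color \<open>r\<close>, and the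
  other side \<open>T\<close> carries only \<open>r\<close>. In the second round every vertex of \<open>T\<close> is then stuck, so Alice must
  destroy a color class of \<open>S\<close> that consists of a single available vertex. Bob restores the lost
  color with a vertex whose old class keeps a vertex already used in this round. Since \<open>S\<close> has at
  least five vertices in at most three classes, at most two classes are singletons, and Alice runs
  out of such moves.\<close>

section \<open>Positions from which Bob forces a win\<close>

text \<open>Derivations are well-founded, so play along one must end with a win for Bob. Rule
  \<open>alice\<close> ranges over legal moves only, because choosing a vertex without a legal color
  already loses for her; if she has no legal move, it applies vacuously.\<close>

inductive bob_wins :: "'v graph \<Rightarrow> nat \<Rightarrow> 'v position \<Rightarrow> bool" for G k where
  alice: "to_move p = Alice \<Longrightarrow>
    (\<And>v x. v \<in> available p \<Longrightarrow> x \<in> legal_colors G k p v \<Longrightarrow> bob_wins G k (make_move G p (v, x))) \<Longrightarrow>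
    bob_wins G k p"
| bob_stuck: "to_move p = Bob \<Longrightarrow> v \<in> available p \<Longrightarrow> legal_colors G k p v = {} \<Longrightarrow> bob_wins G k p"
| bob_move: "to_move p = Bob \<Longrightarrow> v \<in> available p \<Longrightarrow> x \<in> legal_colors G k p v \<Longrightarrow>
    bob_wins G k (make_move G p (v, x)) \<Longrightarrow> bob_wins G k p"

lemma position_after_snoc: "position_after G (h @ [m]) = make_move G (position_after G h) m"
  by (simp add: position_after_def)

text \<open>The derivation of \<open>bob_wins\<close> is played out against \<open>\<sigma>\<close>:
  each rule extends \<open>h\<close> by one move, Alice's taken from \<open>\<sigma>\<close> and
  Bob's from the derivation, until a vertex without a legal color is chosen.\<close>

lemma bob_wins_imp_no_winning_strategy:
  assumes "bob_wins G k p" "winning_strategy G k \<sigma>" "play G k \<sigma> h" "p = position_after G h"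
  shows False
  using assms
proof (induction arbitrary: h)
  case (alice p)
  have nb: "\<not> bob_has_won G k h" and ad: "admissible G k p (\<sigma> h)"
    using alice.prems alice.hyps unfolding winning_strategy_def by auto
  have pl: "play G k \<sigma> (h @ [\<sigma> h])"
    using play.step[OF alice.prems(2) nb] ad alice.prems(3) by simp
  then have "\<not> bob_has_won G k (h @ [\<sigma> h])"
    using alice.prems(1) unfolding winning_strategy_def by blast
  then have ne: "legal_colors G k p (fst (\<sigma> h)) \<noteq> {}"
    using alice.prems(3) unfolding bob_has_won_def by blast
  show False
    using alice.IH[of "fst (\<sigma> h)" "snd (\<sigma> h)" "h @ [\<sigma> h]"] ne ad pl alice.prems
    by (auto simp: admissible_def position_after_snoc)
next
  case (bob_stuck p v)
  have nb: "\<not> bob_has_won G k h"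
    using bob_stuck.prems unfolding winning_strategy_def by auto
  \<comment> \<open>The color 0 is a dummy: \<open>v\<close> has no legal color, so every color
    component is admissible.\<close>
  have "play G k \<sigma> (h @ [(v, 0)])"
    by (rule play.step[OF bob_stuck.prems(2) nb]) (use bob_stuck in \<open>auto simp: admissible_def\<close>)
  then have "\<not> bob_has_won G k (h @ [(v, 0)])"
    using bob_stuck.prems(1) unfolding winning_strategy_def by blast
  then show False
    using bob_stuck by (auto simp: bob_has_won_def)
next
  case (bob_move p v x)
  have nb: "\<not> bob_has_won G k h"
    using bob_move.prems unfolding winning_strategy_def by auto
  have "play G k \<sigma> (h @ [(v, x)])"
    by (rule play.step[OF bob_move.prems(2) nb]) (use bob_move in \<open>auto simp: admissible_def\<close>)
  then show False
    using bob_move.IH[of "h @ [(v, x)]"] bob_move.prems by (simp add: position_after_snoc)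
qed

section \<open>Effect of a move and the colors present on a set\<close>

lemma make_move_sel [simp]:
  "coloring (make_move G p (v, x)) = (coloring p)(v \<mapsto> x)"
  "to_move (make_move G p (v, x)) = opponent (to_move p)"
  by (simp_all add: make_move_def)

lemma available_make_move:
  "available (make_move G p (v, x)) =
    (if available p = {v} then verts G else available p - {v})"
  by (simp add: make_move_def)

definition colors_on :: "'v position \<Rightarrow> 'v set \<Rightarrow> nat set" where
  "colors_on p X = {x. \<exists>v\<in>X. coloring p v = Some x}"

lemma colors_onI: "v \<in> X \<Longrightarrow> coloring p v = Some x \<Longrightarrow> x \<in> colors_on p X"
  by (auto simp: colors_on_def)

lemma eq_singleton_if_card_le_1:
  assumes "finite A" "card A \<le> 1" "r \<in> A"
  shows "A = {r}"
  using assms by (metis One_nat_def card_le_Suc0_iff_eq insertI1 is_singletonI' is_singleton_the_elem singletonD empty_iff)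

section \<open>The game on a complete bipartite graph\<close>

text \<open>The sides stay abstract so that \<open>S\<close> can stand for whichever side Alice
  opens on. All \<open>k\<close> up to 4 are treated together, since a counterexample to the bound
  could have any such value as its minimum.\<close>

locale bipartite_game =
  fixes G :: "'v graph" and S T :: "'v set" and k :: nat
  assumes verts_eq: "verts G = S \<union> T"
    and edges_eq: "edges G = {{s, t} | s t. s \<in> S \<and> t \<in> T}"
    and disjoint: "S \<inter> T = {}"
    and finite_parts: "finite S" "finite T"
    and card_parts: "card S \<ge> 5" "card T \<ge> 5"
    and few_colors: "k \<le> 4"
begin

lemma edge_iff: "{u, v} \<in> edges G \<longleftrightarrow> u \<in> S \<and> v \<in> T \<or> u \<in> T \<and> v \<in> S"
  unfolding edges_eq by (auto simp: doubleton_eq_iff)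

lemma legal_S: "v \<in> S \<Longrightarrow>
    legal_colors G k p v = {x \<in> {1..k}. coloring p v \<noteq> Some x \<and> x \<notin> colors_on p T}"
  using disjoint by (auto simp: legal_colors_def edge_iff colors_on_def)

lemma legal_T: "v \<in> T \<Longrightarrow>
    legal_colors G k p v = {x \<in> {1..k}. coloring p v \<noteq> Some x \<and> x \<notin> colors_on p S}"
  using disjoint by (auto simp: legal_colors_def edge_iff colors_on_def)

section \<open>Later rounds: one side untouched and monochromatic\<close>

text \<open>The condition \<open>T \<subseteq> available p\<close> expresses that \<open>T\<close>
  has not been touched in the current round; \<open>{1..k} - {r}\<close> is the palette left for
  \<open>S\<close>.\<close>

definition locked :: "'v position \<Rightarrow> nat \<Rightarrow> bool" where
  "locked p r \<longleftrightarrow> r \<in> {1..k} \<and> T \<subseteq> available p \<and> (\<forall>t\<in>T. coloring p t = Some r) \<and>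
     (\<forall>s\<in>S. \<exists>x\<in>{1..k} - {r}. coloring p s = Some x)"

lemma locked_color: "locked p r \<Longrightarrow> s \<in> S \<Longrightarrow> \<exists>x\<in>{1..k} - {r}. coloring p s = Some x"
  by (simp add: locked_def)

lemma T_nonempty: "T \<noteq> {}"
  using card_parts by auto

lemma locked_legal:
  assumes "locked p r"
  shows "s \<in> S \<Longrightarrow> legal_colors G k p s = {x \<in> {1..k} - {r}. coloring p s \<noteq> Some x}"
    and "t \<in> T \<Longrightarrow> legal_colors G k p t = {1..k} - {r} - colors_on p S"
  using assms T_nonempty by (auto simp: legal_S legal_T locked_def colors_on_def)

text \<open>An untouched vertex of \<open>T\<close> remains, so a move on \<open>S\<close> cannot
  complete the round and \<open>available\<close> is not reset.\<close>

lemma locked_available: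
  assumes "locked p r" "s \<in> S"
  shows "available (make_move G p (s, x)) = available p - {s}"
  using assms T_nonempty disjoint by (auto simp: locked_def available_make_move)

lemma locked_move:
  assumes "locked p r" "s \<in> S" "x \<in> {1..k} - {r}"
  shows "locked (make_move G p (s, x)) r"
  unfolding locked_def locked_available[OF assms(1,2)]
  using assms disjoint by (auto simp: locked_def)

text \<open>A vertex of \<open>T\<close> has color \<open>r\<close> itself and sees all other colors
  on \<open>S\<close>, so Bob wins by choosing it.\<close>

lemma locked_bob:
  assumes "locked p r" "to_move p = Bob" "{1..k} - {r} \<subseteq> colors_on p S"
  shows "bob_wins G k p"
proof -
  obtain t where "t \<in> T" using T_nonempty by auto
  then show ?thesis
    using assms locked_legal(2)[OF assms(1), of t]
    by (intro bob_stuck[of p t]) (auto simp: locked_def)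
qed

lemma locked_bob_move:
  assumes "locked p r" "to_move p = Bob" "s \<in> S" "s \<in> available p" "x \<in> {1..k} - {r}"
    "coloring p s \<noteq> Some x" "bob_wins G k (make_move G p (s, x))"
  shows "bob_wins G k p"
  using assms by (intro bob_move[of p s x]) (auto simp: locked_legal(1))

text \<open>Alice is forced to recolor a vertex that is alone in its color class.\<close>

lemma locked_alice:
  assumes L: "locked p r" and A: "to_move p = Alice" and full: "{1..k} - {r} \<subseteq> colors_on p S"
    and step: "\<And>s x y. s \<in> S \<Longrightarrow> s \<in> available p \<Longrightarrow> x \<in> {1..k} - {r} \<Longrightarrow> y \<in> {1..k} - {r} \<Longrightarrow>
      x \<noteq> y \<Longrightarrow> coloring p s = Some y \<Longrightarrow> (\<And>u. u \<in> S \<Longrightarrow> coloring p u = Some y \<Longrightarrow> u = s) \<Longrightarrow>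
      bob_wins G k (make_move G p (s, x))"
    and av: "available p \<subseteq> S \<union> T"
  shows "bob_wins G k p"
proof (rule alice[OF A])
  fix v x assume v: "v \<in> available p" and x: "x \<in> legal_colors G k p v"
  \<comment> \<open>By \<open>full\<close>, vertices of \<open>T\<close> have no legal
    color.\<close>
  have vS: "v \<in> S"
    using v av x full locked_legal(2)[OF L, of v] by auto
  then have x': "x \<in> {1..k} - {r}" "coloring p v \<noteq> Some x"
    using x by (auto simp: locked_legal(1)[OF L])
  obtain y where y: "y \<in> {1..k} - {r}" "coloring p v = Some y"
    using locked_color[OF L vS] by blast
  show "bob_wins G k (make_move G p (v, x))"
  proof (cases "\<forall>u\<in>S. coloring p u = Some y \<longrightarrow> u = v")
    case True
    then have uniq: "u = v" if "u \<in> S" "coloring p u = Some y" for u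
      using that by blast
    have "x \<noteq> y" using x'(2) y(2) by auto
    show ?thesis by (rule step[OF vS v x'(1) y(1) \<open>x \<noteq> y\<close> y(2) uniq])
  next
    case False
    \<comment> \<open>The vertex \<open>u\<close> keeps \<open>y\<close> present on
      \<open>S\<close>, so no color is lost and Bob wins at once by
      \<open>locked_bob\<close>.\<close>
    then obtain u where u: "u \<in> S" "coloring p u = Some y" "u \<noteq> v" by blast
    have "{1..k} - {r} \<subseteq> colors_on (make_move G p (v, x)) S"
    proof
      fix q assume "q \<in> {1..k} - {r}"
      then obtain w where w: "w \<in> S" "coloring p w = Some q"
        using full by (auto simp: colors_on_def)
      show "q \<in> colors_on (make_move G p (v, x)) S"
        using w u y by (cases "w = v") (auto simp: colors_on_def)
    qed
    then show ?thesis
      by (intro locked_bob[OF locked_move[OF L vS x'(1)]]) (auto simp: A)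
  qed
qed

text \<open>Alice cannot erase such a color from \<open>S\<close> in one move: its class has a
  vertex already used in this round, or at least two vertices.\<close>

definition safe :: "'v position \<Rightarrow> nat \<Rightarrow> bool" where
  "safe p x \<longleftrightarrow> (\<exists>u\<in>S. coloring p u = Some x \<and>
     (u \<notin> available p \<or> (\<exists>u'\<in>S. u' \<noteq> u \<and> coloring p u' = Some x)))"

lemma safe_colors_on: "safe p x \<Longrightarrow> x \<in> colors_on p S"
  by (auto simp: safe_def colors_on_def)

lemma singleton_not_safe:
  assumes "s \<in> available p" "\<And>u. u \<in> S \<Longrightarrow> coloring p u = Some y \<Longrightarrow> u = s"
  shows "\<not> safe p y"
proof
  assume "safe p y"
  then obtain u where u: "u \<in> S" "coloring p u = Some y"
    and *: "u \<notin> available p \<or> (\<exists>u'\<in>S. u' \<noteq> u \<and> coloring p u' = Some y)"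
    unfolding safe_def by blast
  have "u = s" using assms(2) u .
  then show False using * assms by blast
qed

text \<open>By \<open>locked_alice\<close> only recoloring an available vertex that is alone in its
  class could help Alice, and the color of such a vertex is not safe.\<close>

lemma locked_all_safe:
  assumes L: "locked p r" and A: "to_move p = Alice" and av: "available p \<subseteq> S \<union> T"
    and safe: "\<And>x. x \<in> {1..k} - {r} \<Longrightarrow> safe p x"
  shows "bob_wins G k p"
proof (rule locked_alice[OF L A _ _ av])
  show "{1..k} - {r} \<subseteq> colors_on p S" using safe safe_colors_on by blast
  fix s x y
  assume s: "s \<in> available p" and y: "y \<in> {1..k} - {r}"
    and uniq: "\<And>u. u \<in> S \<Longrightarrow> coloring p u = Some y \<Longrightarrow> u = s"
  have "\<not> safe p y" by (rule singleton_not_safe[OF s uniq])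
  then show "bob_wins G k (make_move G p (s, x))"
    using safe[OF y] by contradiction
qed

text \<open>After Alice gives up the color \<open>x0\<close>, Bob restores it with a vertex whose old class keeps a
  vertex that is no longer available.\<close>

lemma locked_one_unsafe:
  assumes L: "locked p r" and A: "to_move p = Alice" and av: "available p \<subseteq> S \<union> T"
    and x0: "x0 \<in> colors_on p S"
    and safe: "\<And>x. x \<in> {1..k} - {r} \<Longrightarrow> x \<noteq> x0 \<Longrightarrow> safe p x"
    and reply: "(\<forall>y\<in>{1..k} - {r} - {x0}. \<exists>w\<in>S \<inter> available p. coloring p w = Some y) \<or>
      (\<exists>z w u. z \<noteq> x0 \<and> w \<in> S \<inter> available p \<and> u \<in> S - available p \<and>
         coloring p w = Some z \<and> coloring p u = Some z)"
  shows "bob_wins G k p"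
proof (rule locked_alice[OF L A _ _ av])
  show "{1..k} - {r} \<subseteq> colors_on p S" using safe safe_colors_on x0 by blast
  fix s x y
  assume s: "s \<in> S" "s \<in> available p" and x: "x \<in> {1..k} - {r}" and y: "y \<in> {1..k} - {r}"
    and "x \<noteq> y" and sy: "coloring p s = Some y"
    and uniq: "\<And>u. u \<in> S \<Longrightarrow> coloring p u = Some y \<Longrightarrow> u = s"
  have "\<not> safe p y" by (rule singleton_not_safe[OF s(2) uniq])
  then have yx0: "y = x0"
    using safe[OF y] by blast
  let ?p1 = "make_move G p (s, x)"
  have L1: "locked ?p1 r" by (rule locked_move[OF L s(1) x])
  have av1: "available ?p1 = available p - {s}" by (rule locked_available[OF L s(1)])
  \<comment> \<open>Bob will recolor \<open>w\<close> from \<open>z\<close> to \<open>x0\<close>,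
    while the used vertex \<open>u\<close> preserves \<open>z\<close>.\<close>
  have "\<exists>z w u. z \<noteq> x0 \<and> w \<in> S \<and> w \<in> available p \<and> w \<noteq> s \<and> u \<in> S \<and> u \<notin> available ?p1 \<and>
      coloring p w = Some z \<and> coloring ?p1 u = Some z"
    using reply
  proof
    \<comment> \<open>Here \<open>z\<close> is the color \<open>x\<close> that Alice has just given
      to \<open>s\<close>, and \<open>s\<close> itself serves as the used vertex
      \<open>u\<close>.\<close>
    assume *: "\<forall>y\<in>{1..k} - {r} - {x0}. \<exists>w\<in>S \<inter> available p. coloring p w = Some y"
    have "x \<in> {1..k} - {r} - {x0}" using x \<open>x \<noteq> y\<close> yx0 by simp
    from bspec[OF * this]
    obtain w where w: "w \<in> S" "w \<in> available p" "coloring p w = Some x" by blast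
    moreover have "w \<noteq> s" using w(3) sy \<open>x \<noteq> y\<close> by auto
    moreover have "s \<notin> available ?p1" unfolding av1 by simp
    moreover have "coloring ?p1 s = Some x" by simp
    ultimately show ?thesis using \<open>x \<noteq> y\<close> yx0 s(1) by blast
  next
    assume "\<exists>z w u. z \<noteq> x0 \<and> w \<in> S \<inter> available p \<and> u \<in> S - available p \<and>
         coloring p w = Some z \<and> coloring p u = Some z"
    then obtain z w u where zwu: "z \<noteq> x0" "w \<in> S" "w \<in> available p" "u \<in> S" "u \<notin> available p"
         "coloring p w = Some z" "coloring p u = Some z" by blast
    have "w \<noteq> s" using zwu(1,6) sy yx0 by auto
    moreover have "u \<notin> available ?p1" using zwu(5) unfolding av1 by simp
    moreover have "coloring ?p1 u = Some z" using zwu(5,7) s(2) by auto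
    ultimately show ?thesis using zwu by blast
  qed
  then obtain z w u where z: "z \<noteq> x0" and w: "w \<in> S" "w \<in> available p" "w \<noteq> s"
    and u: "u \<in> S" "u \<notin> available ?p1" and wz: "coloring p w = Some z" and uz: "coloring ?p1 u = Some z"
    by blast
  have wu: "w \<noteq> u" using w u av1 by auto
  let ?p2 = "make_move G ?p1 (w, x0)"
  have L2: "locked ?p2 r" using locked_move[OF L1 w(1)] y yx0 by simp
  have av2: "available ?p2 = available p - {s} - {w}"
    using locked_available[OF L1 w(1)] av1 by simp
  show "bob_wins G k ?p1"
  proof (rule locked_bob_move[OF L1 _ w(1)])
    show "to_move ?p1 = Bob" using A by simp
    show "w \<in> available ?p1" using av1 w by simp
    show "x0 \<in> {1..k} - {r}" using y yx0 by simp
    show "coloring ?p1 w \<noteq> Some x0" using w wz z by simp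
    show "bob_wins G k ?p2"
    proof (rule locked_all_safe[OF L2])
      show "to_move ?p2 = Alice" using A by simp
      show "available ?p2 \<subseteq> S \<union> T" using av av2 by blast
      \<comment> \<open>The color \<open>x0\<close> is held by \<open>w\<close>, now used, and
        \<open>z\<close> by \<open>u\<close>. No other color loses a vertex, since \<open>s\<close>
        had color \<open>x0\<close> and \<open>w\<close> had color \<open>z\<close>, and
        \<open>available\<close> only shrinks.\<close>
      fix q assume q: "q \<in> {1..k} - {r}"
      consider "q = x0" | "q = z" "q \<noteq> x0" | "q \<noteq> x0" "q \<noteq> z" by blast
      then show "safe ?p2 q"
      proof cases
        case 1
        then show ?thesis unfolding safe_def using w av2 by (intro bexI[of _ w]) auto
      next
        case 2
        then show ?thesis unfolding safe_def using u uz wu av1 av2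
          by (intro bexI[of _ u]) auto
      next
        case 3
        have keep: "coloring ?p2 v = Some q" if "coloring p v = Some q" for v
          using that 3 sy yx0 wz by auto
        have "safe p q" using safe q 3 by blast
        then show ?thesis unfolding safe_def av2 using keep by blast
      qed
    qed
  qed
qed

text \<open>Serves the case where \<open>x0\<close> and \<open>x1\<close> are singleton classes. If
  Alice gives \<open>v0\<close> the color \<open>x1\<close>, Bob completes the exchange by giving
  \<open>v1\<close> the color \<open>x0\<close>, and all colors are safe. If she gives it
  \<open>z\<close>, Bob gives \<open>a\<close> the color \<open>x0\<close>, and at most
  \<open>x1\<close> is unsafe.\<close>

lemma locked_two_singletons_reply:
  assumes L: "locked p r" and B: "to_move p = Alice" and av: "available p = S \<union> T"
    and K: "{1..k} - {r} = {x0, x1, z}" and dist: "x0 \<noteq> x1" "x0 \<noteq> z" "x1 \<noteq> z"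
    and v: "v0 \<in> S" "v1 \<in> S" "coloring p v0 = Some x0" "coloring p v1 = Some x1"
    and abd: "a \<in> S" "b \<in> S" "d \<in> S" "a \<noteq> b" "a \<noteq> d" "b \<noteq> d"
    and z: "coloring p a = Some z" "coloring p b = Some z" "coloring p d = Some z"
    and x: "x \<in> {1..k} - {r}" "x \<noteq> x0"
  shows "bob_wins G k (make_move G p (v0, x))"
proof -
  let ?p1 = "make_move G p (v0, x)"
  have L1: "locked ?p1 r" by (rule locked_move[OF L v(1) x(1)])
  have av1: "available ?p1 = S \<union> T - {v0}" using locked_available[OF L v(1)] av by simp
  have ne: "v0 \<noteq> v1" "v0 \<noteq> a" "v0 \<noteq> b" "v0 \<noteq> d" "v1 \<noteq> a" "v1 \<noteq> b" "v1 \<noteq> d"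
    using v z dist by auto
  have K0: "x0 \<in> {1..k} - {r}" using K by blast
  consider "x = x1" | "x = z" using x K by blast
  then show ?thesis
  proof cases
    case 1
    let ?p2 = "make_move G ?p1 (v1, x0)"
    have L2: "locked ?p2 r" by (rule locked_move[OF L1 v(2) K0])
    have av2: "available ?p2 = S \<union> T - {v0} - {v1}"
      using locked_available[OF L1 v(2)] av1 by simp
    show ?thesis
    proof (rule locked_bob_move[OF L1 _ v(2) _ K0])
      show "bob_wins G k ?p2"
      proof (rule locked_all_safe[OF L2])
        fix q assume "q \<in> {1..k} - {r}"
        then consider "q = x0" | "q = x1" | "q = z" using K by blast
        then show "safe ?p2 q"
        proof cases
          case 1
          then show ?thesis unfolding safe_def av2 using v by (intro bexI[of _ v1]) auto
        next
          case 2
          then show ?thesis unfolding safe_def av2 using v ne \<open>x = x1\<close>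
            by (intro bexI[of _ v0]) auto
        next
          case 3
          then show ?thesis unfolding safe_def using z abd ne
            by (intro bexI[of _ a] conjI disjI2 bexI[of _ b]) auto
        qed
      qed (use B av2 in auto)
    qed (use B av1 v ne dist in auto)
  next
    case 2
    let ?p2 = "make_move G ?p1 (a, x0)"
    have L2: "locked ?p2 r" by (rule locked_move[OF L1 abd(1) K0])
    have av2: "available ?p2 = S \<union> T - {v0} - {a}"
      using locked_available[OF L1 abd(1)] av1 by simp
    show ?thesis
    proof (rule locked_bob_move[OF L1 _ abd(1) _ K0])
      show "bob_wins G k ?p2"
      proof (rule locked_one_unsafe[OF L2, of x1])
        have "coloring ?p2 v1 = Some x1" using v(4) ne by simp
        then show "x1 \<in> colors_on ?p2 S" by (rule colors_onI[OF v(2)])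
        show "safe ?p2 q" if q: "q \<in> {1..k} - {r}" "q \<noteq> x1" for q
        proof -
          have "q \<in> {x0, x1, z}" using q(1) unfolding K .
          then consider "q = x0" | "q = z" using q(2) by blast
          then show ?thesis
          proof cases
            case 1
            then show ?thesis unfolding safe_def av2 using abd by (intro bexI[of _ a]) auto
          next
            case 2
            then show ?thesis unfolding safe_def av2 using v ne \<open>x = z\<close>
              by (intro bexI[of _ v0]) auto
          qed
        qed
        \<comment> \<open>The class of \<open>z\<close> now has the available vertex
          \<open>b\<close> and the used vertex \<open>v0\<close>, which is the second alternative of
          \<open>reply\<close>.\<close>
        have "coloring ?p2 b = Some z" "coloring ?p2 v0 = Some z" "b \<in> S \<inter> available ?p2"
          "v0 \<in> S - available ?p2"
          unfolding av2 using ne abd v(1) z(2) \<open>x = z\<close> by auto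
        then show "(\<forall>y\<in>{1..k} - {r} - {x1}. \<exists>w\<in>S \<inter> available ?p2. coloring ?p2 w = Some y) \<or>
          (\<exists>z w u. z \<noteq> x1 \<and> w \<in> S \<inter> available ?p2 \<and> u \<in> S - available ?p2 \<and>
             coloring ?p2 w = Some z \<and> coloring ?p2 u = Some z)"
          using dist(3)[symmetric]
          by (intro disjI2 exI[of _ z] exI[of _ b] exI[of _ v0] conjI)
      qed (use B av2 in auto)
    qed (use B av1 abd z ne dist in auto)
  qed
qed

text \<open>If Alice moves, the unsafe colors are counted; at the start of a round these are the
  singleton classes. With two of them, \<open>k \<le> 4\<close> leaves one color for all other
  vertices of \<open>S\<close>. The sizes of the sides may differ, so Bob may also be first to
  move.\<close>

lemma locked_round_start:
  assumes L: "locked p r" and av: "available p = S \<union> T"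
    and full: "{1..k} - {r} \<subseteq> colors_on p S"
  shows "bob_wins G k p"
proof (cases "to_move p")
  case Bob
  then show ?thesis using locked_bob[OF L _ full] by blast
next
  case Alice
  have r: "r \<in> {1..k}" using L by (simp add: locked_def)
  have some_w: "\<exists>w\<in>S \<inter> available p. coloring p w = Some y" if "y \<in> {1..k} - {r}" for y
    using full that av by (auto simp: colors_on_def)
  have alone: "u = v" if "\<not> safe p x" "u \<in> S" "v \<in> S" "coloring p u = Some x" "coloring p v = Some x"
    for x u v
    using that unfolding safe_def by blast
  show ?thesis
  proof (cases "\<forall>x\<in>{1..k} - {r}. safe p x")
    case True
    then show ?thesis using locked_all_safe[OF L Alice] av by auto
  next
    case False
    then obtain x0 where x0: "x0 \<in> {1..k} - {r}" "\<not> safe p x0" by blast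
    show ?thesis
    proof (cases "\<forall>x\<in>{1..k} - {r}. x \<noteq> x0 \<longrightarrow> safe p x")
      case True
      then show ?thesis
        using locked_one_unsafe[OF L Alice, of x0] av full x0 some_w by blast
    next
      case False
      then obtain x1 where x1: "x1 \<in> {1..k} - {r}" "x1 \<noteq> x0" "\<not> safe p x1" by blast
      obtain v0 where v0: "v0 \<in> S" "coloring p v0 = Some x0" using some_w x0 by blast
      obtain v1 where v1: "v1 \<in> S" "coloring p v1 = Some x1" using some_w x1 by blast
      have "card (S - {v0, v1}) \<ge> 3"
        using card_parts(1) finite_parts(1) v0 v1 x1(2) 
        by (subst card_Diff_subset) (auto simp: card_insert_if)
      then obtain X where X: "X \<subseteq> S - {v0, v1}" "card X = 3"
        by (meson obtain_subset_with_card_n)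
      then obtain a b d where X3: "X = {a, b, d}" "a \<noteq> b" "a \<noteq> d" "b \<noteq> d"
        by (auto simp: card_3_iff)
      have abd: "a \<in> S" "b \<in> S" "d \<in> S" using X X3 by auto
      have other: "\<exists>z\<in>{1..k} - {r} - {x0, x1}. coloring p u = Some z" if "u \<in> X" for u
      proof -
        have u: "u \<in> S" "u \<noteq> v0" "u \<noteq> v1" using that X by auto
        then obtain z where z: "z \<in> {1..k} - {r}" "coloring p u = Some z"
          using locked_color[OF L] by blast
        moreover have "z \<noteq> x0" using alone[OF x0(2)] u z v0 by blast
        moreover have "z \<noteq> x1" using alone[OF x1(3)] u z v1 by blast
        ultimately show ?thesis by blast
      qed
      \<comment> \<open>At most four colors, less the three distinct colors \<open>r\<close>,
        \<open>x0\<close> and \<open>x1\<close>.\<close>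
      have card: "card ({1..k} - {r} - {x0, x1}) \<le> 1"
        using few_colors r x0(1) x1(1,2) by (simp add: card_Diff_subset)
      obtain z where z: "z \<in> {1..k} - {r} - {x0, x1}" "coloring p a = Some z"
        using other[of a] X3(1) by blast
      have Z: "{1..k} - {r} - {x0, x1} = {z}"
        by (rule eq_singleton_if_card_le_1[OF _ card z(1)]) simp
      have zb: "coloring p b = Some z" and zd: "coloring p d = Some z"
        using other[of b] other[of d] X3(1) unfolding Z by simp_all
      have K: "{1..k} - {r} = {x0, x1, z}" using Z x0(1) x1(1) by blast
      show ?thesis
      proof (rule locked_alice[OF L Alice full])
        show "available p \<subseteq> S \<union> T" using av by simp
        fix s x y
        assume s: "s \<in> S" "s \<in> available p" and x: "x \<in> {1..k} - {r}" and y: "y \<in> {1..k} - {r}"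
          and "x \<noteq> y" and sy: "coloring p s = Some y"
          and uniq: "\<And>u. u \<in> S \<Longrightarrow> coloring p u = Some y \<Longrightarrow> u = s"
        \<comment> \<open>The class of \<open>z\<close> contains both \<open>a\<close> and
          \<open>b\<close>, so the forced move is at \<open>v0\<close> or \<open>v1\<close>; the
          second case exchanges their roles.\<close>
        have "y \<noteq> z" using uniq[of a] uniq[of b] z(2) zb abd X3 by auto
        then consider "y = x0" | "y = x1" using y K by blast
        then show "bob_wins G k (make_move G p (s, x))"
        proof cases
          case 1
          then have "s = v0" using uniq v0 by blast
          then show ?thesis
            using locked_two_singletons_reply[OF L Alice av K _ _ _ v0(1) v1(1) v0(2) v1(2) abd X3(2-4) z(2) zb zd x]
              x1(2) z(1) 1 \<open>x \<noteq> y\<close> by blast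
        next
          case 2
          then have "s = v1" using uniq v1 by blast
          moreover have "{1..k} - {r} = {x1, x0, z}" using K by blast
          ultimately show ?thesis
            using locked_two_singletons_reply[OF L Alice av _ _ _ _ v1(1) v0(1) v1(2) v0(2) abd X3(2-4) z(2) zb zd x]
              x1(2) z(1) 2 \<open>x \<noteq> y\<close> by blast
        qed
      qed
    qed
  qed
qed

section \<open>The first round\<close>

text \<open>Recognizes the first round without a move counter: once it is over, all vertices are
  colored and available again, so the equation fails.\<close>

definition first_round :: "'v position \<Rightarrow> bool" where
  "first_round p \<longleftrightarrow> available p = {v \<in> S \<union> T. coloring p v = None}"

lemma first_round_move:
  assumes "first_round p" "v \<in> available p" "available p \<noteq> {v}"
  shows "first_round (make_move G p (v, x))"
  using assms by (auto simp: first_round_def available_make_move)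

text \<open>Coloring an uncolored vertex erases no color, so in the first round color sets only
  grow.\<close>

lemma colors_on_move:
  assumes "coloring p v = None"
  shows "colors_on (make_move G p (v, x)) X = (if v \<in> X then insert x (colors_on p X) else colors_on p X)"
  using assms by (force simp: colors_on_def)

text \<open>The split of colors preserves itself: \<open>r\<close> is illegal on \<open>S\<close>,
  and only \<open>r\<close> can be legal on \<open>T\<close>. Whatever is played, the round ends in
  a \<open>locked\<close> position unless Bob finds a stuck vertex earlier. The induction is on the
  number of uncolored vertices.\<close>

lemma first_round_locked:
  assumes "first_round p" "available p \<noteq> {}" "colors_on p T = {r}" "r \<in> {1..k}"
    "colors_on p S = {1..k} - {r}"
  shows "bob_wins G k p"
  using assms
proof (induction "card (available p)" arbitrary: p rule: less_induct)
  case less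
  have fin: "finite (available p)"
    using less.prems(1) finite_parts by (simp add: first_round_def)
  have move: "bob_wins G k (make_move G p (v, x))"
    if v: "v \<in> available p" and x: "x \<in> legal_colors G k p v" for v x
  proof -
    let ?p = "make_move G p (v, x)"
    have none: "coloring p v = None" and vV: "v \<in> S \<union> T"
      using v less.prems(1) by (auto simp: first_round_def)
    have "x \<in> {1..k} - {r}" if "v \<in> S" using that x less.prems legal_S by auto
    moreover have "x = r" if "v \<in> T" using that x less.prems legal_T by auto
    ultimately have cT: "colors_on ?p T = {r}" and cS: "colors_on ?p S = {1..k} - {r}"
      using less.prems vV disjoint by (auto simp: colors_on_move[OF none])
    show ?thesis
    proof (cases "available p = {v}")
      case False
      have F: "first_round ?p" using first_round_move[OF less.prems(1) v False] .
      have av: "available ?p = available p - {v}" using False by (simp add: available_make_move)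
      have "card (available ?p) < card (available p)"
        unfolding av using card_Diff1_less[OF fin v] .
      moreover have "available ?p \<noteq> {}" unfolding av using v False by blast
      ultimately show ?thesis using less.hyps F cT less.prems(4) cS by blast
    next
      case True
      \<comment> \<open>The last uncolored vertex has been filled, so every vertex has a color from
        the set of its side.\<close>
      have "coloring ?p u \<noteq> None" if "u \<in> S \<union> T" for u
        using True less.prems(1) that by (auto simp: first_round_def)
      then have col: "\<exists>y\<in>colors_on ?p X. coloring ?p u = Some y" if "u \<in> X" "X \<subseteq> S \<union> T" for u X
        using that colors_onI by (metis not_None_eq subsetD)
      have avp: "available ?p = S \<union> T" using True verts_eq by (simp add: available_make_move)
      have "coloring ?p t = Some r" if "t \<in> T" for t
        using col[OF that] unfolding cT by auto
      moreover have "\<exists>y\<in>{1..k} - {r}. coloring ?p s = Some y" if "s \<in> S" for s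
        using col[OF that] unfolding cS by blast
      ultimately have "locked ?p r"
        unfolding locked_def using avp less.prems(4) by blast
      then show ?thesis using locked_round_start avp cS by simp
    qed
  qed
  obtain v where v: "v \<in> available p" using less.prems by blast
  show ?case
  proof (cases "to_move p")
    case Alice
    show ?thesis by (rule alice[OF Alice move])
  next
    case Bob
    show ?thesis
    proof (cases "legal_colors G k p v = {}")
      case True
      show ?thesis by (rule bob_stuck[OF Bob v True])
    next
      case False
      then obtain x where x: "x \<in> legal_colors G k p v" by blast
      show ?thesis by (rule bob_move[OF Bob v x move[OF v x]])
    qed
  qed
qed

text \<open>All of \<open>T\<close> is stuck. Alice can legally color only vertices of
  \<open>S\<close>, which frees nothing, and Bob then chooses in \<open>T\<close>.\<close>

lemma first_round_blocked:
  assumes F: "first_round p" and Tav: "T \<subseteq> available p" and full: "{1..k} \<subseteq> colors_on p S"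
  shows "bob_wins G k p"
proof -
  obtain t where t: "t \<in> T" using T_nonempty by auto
  have stuck: "bob_wins G k q" if "to_move q = Bob" "T \<subseteq> available q" "{1..k} \<subseteq> colors_on q S" for q
    using that t by (intro bob_stuck[of q t]) (auto simp: legal_T)
  show ?thesis
  proof (cases "to_move p")
    case Bob
    then show ?thesis using stuck Tav full by blast
  next
    case Alice
    show ?thesis
    proof (rule alice[OF Alice])
      fix v x assume v: "v \<in> available p" and x: "x \<in> legal_colors G k p v"
      have none: "coloring p v = None" and vV: "v \<in> S \<union> T"
        using v F by (auto simp: first_round_def)
      have "v \<notin> T" using x full by (auto simp: legal_T)
      then show "bob_wins G k (make_move G p (v, x))"
        using Alice Tav full vV t
        by (intro stuck) (auto simp: colors_on_move[OF none] available_make_move)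
    qed
  qed
qed

text \<open>Bob puts the missing color on \<open>T\<close> and reaches
  \<open>first_round_locked\<close>. Alice moving on \<open>T\<close> must do the same herself, and
  her moves on \<open>S\<close> can only shrink the set of missing colors.\<close>

lemma first_round_one_missing:
  assumes F: "first_round p" and Tav: "T \<subseteq> available p"
    and one: "card ({1..k} - colors_on p S) \<le> 1" and cS: "colors_on p S \<subseteq> {1..k}"
  shows "bob_wins G k p"
proof -
  \<comment> \<open>A second vertex of \<open>T\<close> keeps the round from ending when the first
    one is colored.\<close>
  have "2 \<le> card T" using card_parts(2) by linarith
  then obtain T' where T': "T' \<subseteq> T" "card T' = 2" by (rule obtain_subset_with_card_n)
  then obtain t t' where t: "t \<in> T" "t' \<in> T" "t \<noteq> t'" by (auto simp: card_2_iff)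
  have noT: "colors_on q T = {}" if "first_round q" "T \<subseteq> available q" for q
    using that by (auto simp: first_round_def colors_on_def)
  have play_T: "bob_wins G k (make_move G q (u, r))"
    if q: "first_round q" "T \<subseteq> available q" "{1..k} - colors_on q S = {r}" "colors_on q S \<subseteq> {1..k}"
      and u: "u \<in> T" for q r u
  proof -
    have none: "coloring q u = None" and ua: "u \<in> available q" using q u by (auto simp: first_round_def)
    obtain u' where u': "u' \<in> T" "u' \<noteq> u" using t by metis
    then have ne: "available q \<noteq> {u}" using q(2) by auto
    have uS: "u \<notin> S" using u disjoint by auto
    show ?thesis
    proof (rule first_round_locked[OF first_round_move[OF q(1) ua ne]])
      show "available (make_move G q (u, r)) \<noteq> {}"
        using ne u' q(2) by (auto simp: available_make_move)
      show "colors_on (make_move G q (u, r)) T = {r}"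
        using u noT[OF q(1,2)] by (simp add: colors_on_move[OF none])
      show "r \<in> {1..k}" using q(3) by blast
      have "colors_on q S = {1..k} - {r}" using q(3,4) by blast
      then show "colors_on (make_move G q (u, r)) S = {1..k} - {r}"
        using uS by (simp add: colors_on_move[OF none])
    qed
  qed
  have bob: "bob_wins G k q"
    if q: "first_round q" "T \<subseteq> available q" "card ({1..k} - colors_on q S) \<le> 1"
      "colors_on q S \<subseteq> {1..k}" and B: "to_move q = Bob" for q
  proof (cases "{1..k} \<subseteq> colors_on q S")
    case True
    then show ?thesis using first_round_blocked q by blast
  next
    case False
    then obtain r where r': "r \<in> {1..k} - colors_on q S" by blast
    have r: "{1..k} - colors_on q S = {r}"
      by (rule eq_singleton_if_card_le_1[OF _ q(3) r']) simp
    have "coloring q t = None" using q t by (auto simp: first_round_def)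
    then have "r \<in> legal_colors G k q t" using r' t(1) by (simp add: legal_T)
    moreover have "t \<in> available q" using q(2) t(1) by blast
    ultimately show ?thesis
      using bob_move[OF B _ _ play_T[OF q(1,2) r q(4) t(1)]] by simp
  qed
  show ?thesis
  proof (cases "to_move p")
    case Bob
    then show ?thesis using bob assms by blast
  next
    case Alice
    show ?thesis
    proof (rule alice[OF Alice])
      fix v x assume v: "v \<in> available p" and x: "x \<in> legal_colors G k p v"
      have none: "coloring p v = None" and vV: "v \<in> S \<union> T"
        using v F by (auto simp: first_round_def)
      show "bob_wins G k (make_move G p (v, x))"
      proof (cases "v \<in> T")
        case True
        then have "x \<in> {1..k} - colors_on p S" using x by (simp add: legal_T)
        then have missing: "{1..k} - colors_on p S = {x}"
          by (rule eq_singleton_if_card_le_1[OF _ one, rotated]) simp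
        show ?thesis by (rule play_T[OF F Tav missing cS True])
      next
        case False
        then have vS: "v \<in> S" using vV by blast
        have ne: "available p \<noteq> {v}" using Tav t(1) False by auto
        have cm: "colors_on (make_move G p (v, x)) S = insert x (colors_on p S)"
          using vS by (simp add: colors_on_move[OF none])
        show ?thesis
        proof (rule bob)
          show "first_round (make_move G p (v, x))" using first_round_move[OF F v ne] .
          show "T \<subseteq> available (make_move G p (v, x))" using ne Tav False by (auto simp: available_make_move)
          have "card ({1..k} - insert x (colors_on p S)) \<le> card ({1..k} - colors_on p S)"
            by (intro card_mono) auto
          then show "card ({1..k} - colors_on (make_move G p (v, x)) S) \<le> 1"
            using one cm by simp
          show "colors_on (make_move G p (v, x)) S \<subseteq> {1..k}"
            using cm cS x vS by (auto simp: legal_S)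
        qed (use Alice in simp)
      qed
    qed
  qed
qed

text \<open>Bob answers with a new color \<open>y\<close> on \<open>S\<close>. If Alice then colors
  in \<open>T\<close> with \<open>z\<close>, at most one color is left for Bob to add to
  \<open>S\<close>. If she stays on \<open>S\<close>, Bob adds another new color whenever two or
  more are missing, so that at most one remains.\<close>

lemma opening_move:
  assumes p0: "coloring p = (\<lambda>_. None)" "available p = S \<union> T" "to_move p = Alice"
    and v: "v \<in> S" and x: "x \<in> legal_colors G k p v"
  shows "bob_wins G k (make_move G p (v, x))"
proof -
  obtain t where t: "t \<in> T" using T_nonempty by auto
  \<comment> \<open>Five vertices in \<open>S\<close> provide one outside any four named; lists
    allow repetitions among them.\<close>
  have free: "\<exists>w. w \<in> S \<and> w \<notin> set us" if "length us \<le> 4" for us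
  proof (rule ccontr)
    assume "\<not> ?thesis"
    then have "S \<subseteq> set us" by blast
    then have "card S \<le> length us" by (meson card_length card_mono finite_set le_trans)
    then show False using that card_parts(1) by linarith
  qed
  have x1: "x \<in> {1..k}" using x v by (simp add: legal_S)
  let ?p1 = "make_move G p (v, x)"
  have F0: "first_round p" using p0 by (auto simp: first_round_def)
  have av1: "available ?p1 = S \<union> T - {v}" using p0 t v disjoint by (auto simp: available_make_move)
  have "v \<in> available p" "available p \<noteq> {v}" using p0 t v disjoint by auto
  then have F1: "first_round ?p1" by (rule first_round_move[OF F0])
  have c1: "colors_on ?p1 S = {x}" using p0 v disjoint by (auto simp: colors_on_def)
  have TT: "T - {v} = T" using v disjoint by auto
  show ?thesis
  proof (cases "{1..k} = {x}")
    case True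
    then show ?thesis using first_round_blocked[OF F1] av1 c1 v disjoint by blast
  next
    case False
    then obtain y where y: "y \<in> {1..k}" "y \<noteq> x" using x1 by blast
    obtain w where w: "w \<in> S" "w \<noteq> v" using free[of "[v]"] by auto
    let ?p2 = "make_move G ?p1 (w, y)"
    have wa: "w \<in> available ?p1" and ne1: "available ?p1 \<noteq> {w}" using av1 w t disjoint v by auto
    have av2: "available ?p2 = S \<union> T - {v} - {w}" using av1 ne1 by (simp add: available_make_move)
    have F2: "first_round ?p2" using first_round_move[OF F1 wa ne1] .
    have c2: "colors_on ?p2 S = {x, y}" using p0 w v by (auto simp: colors_on_def)
    have cT2: "colors_on ?p2 T = {}" using p0 w v disjoint by (auto simp: colors_on_def)
    have "bob_wins G k ?p2"
    proof (rule alice)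
      show "to_move ?p2 = Alice" using p0 by simp
      fix u z assume u: "u \<in> available ?p2" and z: "z \<in> legal_colors G k ?p2 u"
      let ?p3 = "make_move G ?p2 (u, z)"
      have uV: "u \<in> S \<union> T" "u \<noteq> v" "u \<noteq> w" using u av2 by auto
      have none: "coloring ?p2 u = None" using p0 uV by simp
      have zk: "z \<in> {1..k}" using z by (simp add: legal_colors_def)
      obtain s where s: "s \<in> S" "s \<noteq> v" "s \<noteq> w" "s \<noteq> u" using free[of "[v, w, u]"] by auto
      have sa2: "s \<in> available ?p2" using s av2 by blast
      have ne2: "available ?p2 \<noteq> {u}" using sa2 s(4) by auto
      have av3: "available ?p3 = S \<union> T - {v} - {w} - {u}" using av2 ne2 by (simp add: available_make_move)
      have F3: "first_round ?p3" using first_round_move[OF F2 u ne2] .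
      have sa3: "s \<in> available ?p3" using s av3 by blast
      have s_none: "coloring ?p3 s = None" using s p0 by simp
      \<comment> \<open>The vertex \<open>s'\<close> stays uncolored after Bob's move at
        \<open>s\<close>, so that move does not end the round.\<close>
      obtain s' where s': "s' \<in> S" "s' \<noteq> v" "s' \<noteq> w" "s' \<noteq> u" "s' \<noteq> s"
        using free[of "[v, w, u, s]"] by auto
      have s'a3: "s' \<in> available ?p3" using s' av3 by blast
      have ne3: "available ?p3 \<noteq> {s}" using s'a3 s'(5) by auto
      have B3: "to_move ?p3 = Bob" using p0 by simp
      show "bob_wins G k ?p3"
      proof (cases "u \<in> T")
        case True
        have zxy: "z \<noteq> x" "z \<noteq> y" using z True c2 by (auto simp: legal_T)
        have c3: "colors_on ?p3 S = {x, y}" "colors_on ?p3 T = {z}"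
          using True disjoint c2 cT2 by (auto simp: colors_on_move[OF none])
        have card: "card ({1..k} - {z} - {x, y}) \<le> 1"
          using few_colors zk x1 y zxy by (simp add: card_Diff_subset)
        show ?thesis
        proof (cases "{1..k} - {z} - {x, y} = {}")
          case True
          then have "{1..k} - {z} = {x, y}" using x1 y zxy by blast
          then show ?thesis
            using first_round_locked[OF F3 _ c3(2) zk] c3(1) sa3 by blast
        next
          case False
          then obtain d where d: "d \<in> {1..k} - {z} - {x, y}" by blast
          have one: "{1..k} - {z} - {x, y} = {d}"
            by (rule eq_singleton_if_card_le_1[OF _ card d]) simp
          have K: "{1..k} - {z} = {d, x, y}" using one x1 y zxy by blast
          show ?thesis
          proof (rule bob_move[OF B3 sa3])
            show "d \<in> legal_colors G k ?p3 s"
              using d s c3 s_none by (simp only: legal_S) auto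
            show "bob_wins G k (make_move G ?p3 (s, d))"
            proof (rule first_round_locked[OF first_round_move[OF F3 sa3 ne3]])
              show "available (make_move G ?p3 (s, d)) \<noteq> {}"
                using ne3 s'a3 s' by (subst available_make_move) auto
              show "colors_on (make_move G ?p3 (s, d)) T = {z}"
                using colors_on_move[OF s_none] c3 s disjoint by auto
              show "colors_on (make_move G ?p3 (s, d)) S = {1..k} - {z}"
                unfolding K using s(1) c3(1) by (simp only: colors_on_move[OF s_none] if_True)
            qed (use zk in auto)
          qed
        qed
      next
        case False
        then have uS: "u \<in> S" using uV by blast
        have T3: "T \<subseteq> available ?p3" using av3 False v w disjoint by auto
        have c3: "colors_on ?p3 S = {z, x, y}"
          using uS c2 by (auto simp: colors_on_move[OF none])
        have cT3: "colors_on ?p3 T = {}"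
          using False cT2 by (auto simp: colors_on_move[OF none])
        have sub: "colors_on ?p3 S \<subseteq> {1..k}" unfolding c3 using zk x1 y(1) by simp
        show ?thesis
        proof (cases "card ({1..k} - {z, x, y}) \<le> 1")
          case True
          then show ?thesis using first_round_one_missing[OF F3 T3 _ sub] unfolding c3 by blast
        next
          case c: False
          then have "{1..k} - {z, x, y} \<noteq> {}" using card.empty zero_le by metis
          then obtain d where d: "d \<in> {1..k} - {z, x, y}" by blast
          show ?thesis
          proof (rule bob_move[OF B3 sa3])
            show "d \<in> legal_colors G k ?p3 s"
              using d s cT3 s_none by (simp only: legal_S) auto
            have c4: "colors_on (make_move G ?p3 (s, d)) S = {d, z, x, y}"
              using colors_on_move[OF s_none, of d S] c3 s by auto
            \<comment> \<open>The color \<open>z\<close> may coincide with \<open>x\<close> or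
              \<open>y\<close>, so only the distinct \<open>d\<close>, \<open>x\<close> and
              \<open>y\<close> are counted.\<close>
            have "card ({1..k} - {d, z, x, y}) \<le> card ({1..k} - {d, x, y})"
              by (intro card_mono) auto
            also have "\<dots> \<le> 1"
              using few_colors d x1 y by (simp add: card_Diff_subset)
            finally have le: "card ({1..k} - {d, z, x, y}) \<le> 1" .
            have av4: "available (make_move G ?p3 (s, d)) = available ?p3 - {s}"
              using ne3 by (simp only: available_make_move if_False)
            show "bob_wins G k (make_move G ?p3 (s, d))"
            proof (rule first_round_one_missing[OF first_round_move[OF F3 sa3 ne3]])
              show "T \<subseteq> available (make_move G ?p3 (s, d))"
                unfolding av4 using T3 s(1) disjoint by blast
              show "card ({1..k} - colors_on (make_move G ?p3 (s, d)) S) \<le> 1"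
                unfolding c4 by (rule le)
              show "colors_on (make_move G ?p3 (s, d)) S \<subseteq> {1..k}"
                unfolding c4 using d zk x1 y(1) by simp
            qed
          qed
        qed
      qed
    qed
    moreover have "y \<in> legal_colors G k ?p1 w"
      using y w v p0 disjoint by (auto simp: legal_S colors_on_def)
    ultimately show ?thesis
      using wa p0 by (intro bob_move[of ?p1 w y]) auto
  qed
qed

end

section \<open>Complete bipartite graphs with equal sides\<close>

lemma unordered_pairs_swap: "{{s, t} | s t. s \<in> A \<and> t \<in> B} \<subseteq> {{s, t} | s t. s \<in> B \<and> t \<in> A}"
proof clarify
  fix s t assume "s \<in> A" "t \<in> B"
  then show "\<exists>s' t'. {s, t} = {s', t'} \<and> s' \<in> B \<and> t' \<in> A"
    by (intro exI[of _ t] exI[of _ s]) auto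
qed

text \<open>Two interpretations of the locale exchange the sides, so that \<open>S\<close> is the
  one containing Alice's first vertex.\<close>

lemma bob_wins_complete_bipartite:
  assumes "n \<ge> 5" "k \<le> 4"
  shows "bob_wins (complete_bipartite n n) k (initial_position (complete_bipartite n n))"
proof -
  let ?G = "complete_bipartite n n"
  let ?L = "Inl ` {..<n} :: (nat + nat) set" and ?R = "Inr ` {..<n} :: (nat + nat) set"
  have card: "card ?L = n" "card ?R = n" by (simp_all add: card_image)
  have V: "verts ?G = ?L \<union> ?R" by (auto simp: verts_def complete_bipartite_def)
  have E: "edges ?G = {{s, t} | s t. s \<in> ?L \<and> t \<in> ?R}"
    by (auto simp: edges_def complete_bipartite_def)
  interpret LR: bipartite_game ?G ?L ?R k
    by (unfold_locales, rule V, rule E) (use card assms in auto)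
  interpret RL: bipartite_game ?G ?R ?L k
  proof unfold_locales
    show "verts ?G = ?R \<union> ?L" unfolding V by blast
    show "edges ?G = {{s, t} | s t. s \<in> ?R \<and> t \<in> ?L}"
      unfolding E by (intro equalityI unordered_pairs_swap)
  qed (use card assms in auto)
  show ?thesis
  proof (rule alice)
    let ?p = "initial_position ?G"
    fix v x assume v: "v \<in> available ?p" and x: "x \<in> legal_colors ?G k ?p v"
    have p0: "coloring ?p = (\<lambda>_. None)" "to_move ?p = Alice" "available ?p = ?L \<union> ?R"
      using V by (simp_all add: initial_position_def)
    show "bob_wins ?G k (make_move ?G ?p (v, x))"
    proof (cases "v \<in> ?L")
      case True
      show ?thesis by (rule LR.opening_move[OF p0(1,3,2) True x])
    next
      case False
      have "v \<in> ?R" using v False unfolding p0(3) by blast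
      moreover have "available ?p = ?R \<union> ?L" unfolding p0(3) by (rule Un_commute)
      ultimately show ?thesis using RL.opening_move[OF p0(1) _ p0(2) _ x] by blast
    qed
  qed (simp add: initial_position_def)
qed

section \<open>Existence of the minimum and the bound\<close>

text \<open>Ensures that \<open>LEAST\<close> ranges over a nonempty set, as its value would
  otherwise be unspecified. A vertex can be denied only its own color and those of its neighbors, so
  a legal color always exists and any admissible play wins for Alice.\<close>

lemma winning_strategy_many_colors:
  assumes fin: "finite (verts G)" and ne: "verts G \<noteq> {}"
    and edge: "\<And>u v. {u, v} \<in> edges G \<Longrightarrow> u \<in> verts G"
  shows "\<exists>\<sigma>. winning_strategy G (card (verts G) + 2) \<sigma>"
proof -
  let ?k = "card (verts G) + 2"
  have legal: "legal_colors G ?k p v \<noteq> {}" for p v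
  proof
    assume empty: "legal_colors G ?k p v = {}"
    \<comment> \<open>Here \<open>v\<close> is arbitrary and may lie outside the graph, so up to
      \<open>card (verts G) + 1\<close> colors are excluded, one fewer than
      \<open>?k\<close>.\<close>
    let ?W = "insert v (verts G)"
    have "{1..?k} \<subseteq> (\<lambda>u. the (coloring p u)) ` ?W"
    proof
      fix x assume "x \<in> {1..?k}"
      then have "coloring p v = Some x \<or> (\<exists>u. {u, v} \<in> edges G \<and> coloring p u = Some x)"
        using empty unfolding legal_colors_def by blast
      then show "x \<in> (\<lambda>u. the (coloring p u)) ` ?W"
        using edge by force
    qed
    then have "card {1..?k} \<le> card ?W"
      using fin by (meson card_image_le card_mono finite_imageI finite_insert le_trans)
    also have "\<dots> \<le> card (verts G) + 1" using fin by (simp add: card_insert_if)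
    finally show False by simp
  qed
  have avail: "available (position_after G h) \<noteq> {}" for h
    by (induction h rule: rev_induct)
      (use ne in \<open>auto simp: position_after_snoc make_move_def, auto simp: position_after_def initial_position_def\<close>)
  have "\<exists>m. admissible G ?k (position_after G h) m" for h
  proof -
    obtain v where v: "v \<in> available (position_after G h)" using avail by blast
    obtain x where "x \<in> legal_colors G ?k (position_after G h) v" using legal by blast
    then show ?thesis using v by (intro exI[of _ "(v, x)"]) (simp add: admissible_def)
  qed
  then obtain \<sigma> where "\<And>h. admissible G ?k (position_after G h) (\<sigma> h)" by metis
  then show ?thesis
    using legal by (auto simp: winning_strategy_def bob_has_won_def)
qed

theorem proposition3p7:
  fixes n :: nat
  assumes "n \<ge> 5"
  shows "eternal_game_chromatic_number (complete_bipartite n n) \<ge> 5"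
proof (rule ccontr)
  let ?G = "complete_bipartite n n"
  assume "\<not> ?thesis"
  then have le: "eternal_game_chromatic_number ?G \<le> 4" by simp
  have V: "verts ?G = {..<n} <+> {..<n}" by (simp add: verts_def complete_bipartite_def)
  have "\<exists>\<sigma>. winning_strategy ?G (card (verts ?G) + 2) \<sigma>"
  proof (rule winning_strategy_many_colors)
    show "finite (verts ?G)" by (simp add: V)
    have "Inl 0 \<in> verts ?G" using assms by (auto simp: V)
    then show "verts ?G \<noteq> {}" by blast
    show "u \<in> verts ?G" if "{u, v} \<in> edges ?G" for u v
      using that by (auto simp: verts_def edges_def complete_bipartite_def doubleton_eq_iff)
  qed
  \<comment> \<open>The minimum is attained, so Alice would have a winning strategy with at most
    four colors.\<close>
  then have "\<exists>\<sigma>. winning_strategy ?G (eternal_game_chromatic_number ?G) \<sigma>"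
    unfolding eternal_game_chromatic_number_def by (rule LeastI)
  then obtain \<sigma> where "winning_strategy ?G (eternal_game_chromatic_number ?G) \<sigma>" by blast
  then show False
    using bob_wins_imp_no_winning_strategy[OF bob_wins_complete_bipartite[OF assms le] _ play.start]
    by (simp add: position_after_def)
qed

end
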